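(* The function $[f]\mapsto[\mathfrak{p}_2\circ f]$ provides bijections from $[S^3,S^2]$ onto $[S^3,\mathbb{R}\mathrm{P}^2]$ and from $[\mathbb{R}\mathrm{P}^3,S^2]$ onto $[\mathbb{R}\mathrm{P}^3,\mathbb{R}\mathrm{P}^2]$.
   Context: $[X,Y]$ is the set of homotopy classes of continuous maps $X\to Y$, $[f]$ is the homotopy class of $f$, and $\mathfrak{p}_2:S^2\to\mathbb{R}\mathrm{P}^2$ is the double covering map. *)

theory Defs
  imports "HOL-Analysis.Analysis"
begin

section \<open>Homotopy classes of continuous maps\<close>

text \<open>Homotopies are free (no base points). Since HOL functions are total, a class also contains
  all functions that agree on \<^term>\<open>topspace X\<close> with one of its members; \<^const>\<open>homotopic_with\<close>
  with the trivial predicate does not depend on the values outside \<^term>\<open>topspace X\<close>.\<close>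

definition homotopy_rel :: "'a topology \<Rightarrow> 'b topology \<Rightarrow> (('a \<Rightarrow> 'b) \<times> ('a \<Rightarrow> 'b)) set" where
  "homotopy_rel X Y = {(f, g). homotopic_with (\<lambda>_. True) X Y f g}"

definition homotopy_class :: "'a topology \<Rightarrow> 'b topology \<Rightarrow> ('a \<Rightarrow> 'b) \<Rightarrow> ('a \<Rightarrow> 'b) set" where
  "homotopy_class X Y f = homotopy_rel X Y `` {f}"

definition homotopy_classes :: "'a topology \<Rightarrow> 'b topology \<Rightarrow> ('a \<Rightarrow> 'b) set set" where
  "homotopy_classes X Y = {f. continuous_map X Y f} // homotopy_rel X Y"

lemma equiv_homotopy_rel: "equiv {f. continuous_map X Y f} (homotopy_rel X Y)"
proof (rule equivI)
  show "homotopy_rel X Y \<subseteq> {f. continuous_map X Y f} \<times> {f. continuous_map X Y f}"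
    by (auto simp: homotopy_rel_def dest: homotopic_with_imp_continuous_maps)
  show "refl_on {f. continuous_map X Y f} (homotopy_rel X Y)"
    by (auto simp: refl_on_def homotopy_rel_def)
  show "sym (homotopy_rel X Y)"
    by (auto simp: sym_def homotopy_rel_def intro: homotopic_with_symD)
  show "trans (homotopy_rel X Y)"
    by (auto simp: trans_def homotopy_rel_def intro: homotopic_with_trans)
qed

text \<open>The function \<open>[X,Y] \<rightarrow> [X,Z]\<close>, \<open>[f] \<mapsto> [p \<circ> f]\<close>. The union below runs over all representatives
  of a class; they all contribute the same set, see \<open>postcomp_class_homotopy_class\<close>.\<close>

definition postcomp_class ::
    "'a topology \<Rightarrow> 'c topology \<Rightarrow> ('b \<Rightarrow> 'c) \<Rightarrow> ('a \<Rightarrow> 'b) set \<Rightarrow> ('a \<Rightarrow> 'c) set" where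
  "postcomp_class X Z p C = (\<Union>f\<in>C. homotopy_class X Z (p \<circ> f))"

lemma postcomp_class_homotopy_class:
  assumes p: "continuous_map Y Z p" and f: "continuous_map X Y f"
  shows "postcomp_class X Z p (homotopy_class X Y f) = homotopy_class X Z (p \<circ> f)"
proof -
  have "homotopy_class X Z (p \<circ> g) = homotopy_class X Z (p \<circ> f)" if "g \<in> homotopy_class X Y f" for g
  proof -
    have "homotopic_with (\<lambda>_. True) X Y f g"
      using that by (simp add: homotopy_class_def homotopy_rel_def)
    then have "homotopic_with (\<lambda>_. True) X Z (p \<circ> f) (p \<circ> g)"
      using p by (rule homotopic_with_compose_continuous_map_left) simp
    then have "(p \<circ> f, p \<circ> g) \<in> homotopy_rel X Z"
      by (simp add: homotopy_rel_def)
    then show ?thesis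
      unfolding homotopy_class_def using equiv_class_eq[OF equiv_homotopy_rel] by metis
  qed
  moreover have "f \<in> homotopy_class X Y f"
    using f by (simp add: homotopy_class_def homotopy_rel_def)
  ultimately show ?thesis
    unfolding postcomp_class_def by blast
qed

section \<open>Spheres and real projective spaces\<close>

definition quotient_topology :: "'a topology \<Rightarrow> ('a \<Rightarrow> 'b) \<Rightarrow> 'b topology" where
  "quotient_topology X q =
     topology (\<lambda>U. U \<subseteq> q ` topspace X \<and> openin X {x \<in> topspace X. q x \<in> U})"

lemma openin_quotient_topology:
  "openin (quotient_topology X q) U \<longleftrightarrow>
     U \<subseteq> q ` topspace X \<and> openin X {x \<in> topspace X. q x \<in> U}"
proof -
  have "istopology (\<lambda>U. U \<subseteq> q ` topspace X \<and> openin X {x \<in> topspace X. q x \<in> U})"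
    unfolding istopology_def
  proof (intro conjI allI impI; (elim conjE)?)
    fix S T
    assume "openin X {x \<in> topspace X. q x \<in> S}" "openin X {x \<in> topspace X. q x \<in> T}"
    then have "openin X ({x \<in> topspace X. q x \<in> S} \<inter> {x \<in> topspace X. q x \<in> T})"
      by (rule openin_Int)
    moreover have "{x \<in> topspace X. q x \<in> S} \<inter> {x \<in> topspace X. q x \<in> T}
        = {x \<in> topspace X. q x \<in> S \<inter> T}" by auto
    ultimately show "openin X {x \<in> topspace X. q x \<in> S \<inter> T}" by simp
  next
    fix \<K>
    assume K: "\<forall>K\<in>\<K>. K \<subseteq> q ` topspace X \<and> openin X {x \<in> topspace X. q x \<in> K}"
    then have "openin X (\<Union>K\<in>\<K>. {x \<in> topspace X. q x \<in> K})"
      by blast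
    moreover have "(\<Union>K\<in>\<K>. {x \<in> topspace X. q x \<in> K}) = {x \<in> topspace X. q x \<in> \<Union>\<K>}" by auto
    ultimately show "openin X {x \<in> topspace X. q x \<in> \<Union>\<K>}" by simp
  qed blast+
  then show ?thesis
    by (simp add: quotient_topology_def)
qed

lemma topspace_quotient_topology [simp]: "topspace (quotient_topology X q) = q ` topspace X"
proof
  show "topspace (quotient_topology X q) \<subseteq> q ` topspace X"
    using openin_topspace[of "quotient_topology X q"] unfolding openin_quotient_topology by (rule conjunct1)
  have "{x \<in> topspace X. q x \<in> q ` topspace X} = topspace X" by auto
  then show "q ` topspace X \<subseteq> topspace (quotient_topology X q)"
    by (intro openin_subset) (simp add: openin_quotient_topology)
qed

lemma quotient_map_quotient_topology: "quotient_map X (quotient_topology X q) q"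
  by (simp add: quotient_map_def openin_quotient_topology)

text \<open>Unit sphere of a Euclidean space: \<open>S\<^sup>n\<close> for \<open>real^(n+1)\<close>.\<close>

definition unit_sphere :: "'a::euclidean_space topology" where
  "unit_sphere = top_of_set (sphere 0 1)"

text \<open>The map sending a point of the sphere to its orbit under the antipodal action. On the unit sphere
  of \<open>real^(n+1)\<close> this is the double covering \<open>S\<^sup>n \<rightarrow> RP\<^sup>n\<close>.\<close>

definition antipodal_proj :: "'a::euclidean_space \<Rightarrow> 'a set" where
  "antipodal_proj x = {x, - x}"

text \<open>The quotient of the unit sphere by the antipodal action: \<open>RP\<^sup>n\<close> for \<open>real^(n+1)\<close>.\<close>

definition real_projective_space :: "'a::euclidean_space set topology" where
  "real_projective_space = quotient_topology unit_sphere antipodal_proj"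

lemma antipodal_proj_eq_iff: "antipodal_proj x = antipodal_proj y \<longleftrightarrow> x = y \<or> x = - y"
  by (auto simp: antipodal_proj_def doubleton_eq_iff)

lemma continuous_map_antipodal_proj:
  "continuous_map unit_sphere real_projective_space antipodal_proj"
  unfolding real_projective_space_def
  by (rule quotient_imp_continuous_map[OF quotient_map_quotient_topology])

abbreviation S2 :: "(real^3) topology" where "S2 \<equiv> unit_sphere"
abbreviation S3 :: "(real^4) topology" where "S3 \<equiv> unit_sphere"
abbreviation RP2 :: "(real^3) set topology" where "RP2 \<equiv> real_projective_space"
abbreviation RP3 :: "(real^4) set topology" where "RP3 \<equiv> real_projective_space"

abbreviation double_cover2 :: "real^3 \<Rightarrow> (real^3) set" where "double_cover2 \<equiv> antipodal_proj"

end

theory Submission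
  imports Defs
begin

text \<open>
  Both \<open>S\<^sup>2 \<rightarrow> RP\<^sup>2\<close> and the Hopf map \<open>S\<^sup>3 \<rightarrow> S\<^sup>2\<close> assign to a unit vector the line that it spans, over the
  reals and over the complex numbers. A family of lines is a family of projectors, and a unit vector
  in the line is carried along a path of projectors by projecting and normalizing in small steps. So
  unit vectors can be chosen continuously over each hemisphere of \<open>S\<^sup>3\<close>; on the equator the two
  choices differ by a sign or by a map to the circle, which has a continuous argument that extends.
  Hence maps from \<open>S\<^sup>3\<close> to \<open>RP\<^sup>2\<close> lift to \<open>S\<^sup>2\<close> (and homotopies lift too), and maps from \<open>S\<^sup>3\<close> to \<open>S\<^sup>2\<close>
  lift through the Hopf map.

  Let \<open>h\<close> be a Hopf lift of \<open>F : S\<^sup>3 \<rightarrow> S\<^sup>2\<close>. If \<open>F\<close> is odd, then \<open>h (-x) = u x \<cdot> j (h x)\<close> for the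
  quaternionic structure \<open>j\<close> (here \<open>anti\<close>) and an odd map \<open>u : S\<^sup>3 \<rightarrow> S\<^sup>1\<close>, which cannot exist; so the lift to \<open>S\<^sup>2\<close> of
  a map \<open>S\<^sup>3 \<rightarrow> RP\<^sup>3 \<rightarrow> RP\<^sup>2\<close> is even, which gives surjectivity. If \<open>F\<close> is even, then \<open>h\<close> can be chosen
  even or odd, and rotating \<open>h\<close> to \<open>j h\<close> gives a homotopy through even maps from \<open>F\<close> to \<open>-F\<close>. As two maps
  whose projections to \<open>RP\<^sup>2\<close> are homotopic are homotopic up to sign, this gives injectivity.
\<close>

section \<open>Unit sections of fields of projectors\<close>

text \<open>Records what transport uses: joint continuity on unit vectors, uniform over a compact
  base, and idempotence and real homogeneity, by which a projected and rescaled vector is still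
  fixed. Real and complex lines are covered at once.\<close>

definition projector_field :: "'a::metric_space set \<Rightarrow> ('a \<Rightarrow> 'v::euclidean_space \<Rightarrow> 'v) \<Rightarrow> bool" where
  "projector_field S P \<longleftrightarrow> continuous_on (S \<times> sphere 0 1) (\<lambda>(x, v). P x v) \<and>
     (\<forall>x\<in>S. \<forall>v. P x (P x v) = P x v) \<and> (\<forall>x\<in>S. \<forall>c v. P x (c *\<^sub>R v) = c *\<^sub>R P x v)"

definition unit_section :: "'a::metric_space set \<Rightarrow> ('a \<Rightarrow> 'v::euclidean_space \<Rightarrow> 'v) \<Rightarrow> ('a \<Rightarrow> 'v) \<Rightarrow> bool" where
  "unit_section S P h \<longleftrightarrow> continuous_on S h \<and> (\<forall>x\<in>S. norm (h x) = 1 \<and> P x (h x) = h x)"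

lemma projector_field_pullback:
  assumes P: "projector_field S P" and f: "continuous_on T f" "f ` T \<subseteq> S"
  shows "projector_field T (\<lambda>x. P (f x))"
proof -
  have "continuous_on (T \<times> sphere 0 1) (\<lambda>z. (\<lambda>(x, v). P x v) (f (fst z), snd z))"
  proof (rule continuous_on_compose2[of "S \<times> sphere 0 1" "\<lambda>(x, v). P x v"])
    show "continuous_on (T \<times> sphere 0 1) (\<lambda>z. (f (fst z), snd z))"
      by (intro continuous_intros continuous_on_compose2[OF f(1)]) auto
  qed (use P f in \<open>auto simp: projector_field_def\<close>)
  then show ?thesis
    using P f by (auto simp: projector_field_def case_prod_unfold image_subset_iff)
qed

lemma unit_section_subset: "unit_section S P h \<Longrightarrow> T \<subseteq> S \<Longrightarrow> unit_section T P h"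
  by (auto simp: unit_section_def intro: continuous_on_subset)

text \<open>Parallel transport in small steps: over a compact base, projectors at nearby times
  differ by less than 1 on unit vectors, so projecting a section into the next field never gives
  zero and can be normalized.\<close>

lemma unit_section_homotopy:
  fixes P :: "real \<times> 'a::metric_space \<Rightarrow> 'v::euclidean_space \<Rightarrow> 'v"
  assumes S: "compact S" and P: "projector_field ({0..1} \<times> S) P"
    and h0: "unit_section S (\<lambda>x. P (0, x)) h0"
  obtains h where "unit_section S (\<lambda>x. P (1, x)) h"
proof -
  let ?D = "({0..1::real} \<times> S) \<times> sphere (0::'v) 1"
  have contP: "continuous_on ?D (\<lambda>(z, v). P z v)"
    and idem: "\<And>t x v. t \<in> {0..1} \<Longrightarrow> x \<in> S \<Longrightarrow> P (t, x) (P (t, x) v) = P (t, x) v"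
    and scale: "\<And>t x c v. t \<in> {0..1} \<Longrightarrow> x \<in> S \<Longrightarrow> P (t, x) (c *\<^sub>R v) = c *\<^sub>R P (t, x) v"
    using P by (auto simp: projector_field_def)
  have "compact ?D"
    using S by (intro compact_Times) auto
  then have "uniformly_continuous_on ?D (\<lambda>(z, v). P z v)"
    using contP by (rule compact_uniformly_continuous[rotated])
  then obtain d where "d > 0"
    and d: "\<And>z z'. z \<in> ?D \<Longrightarrow> z' \<in> ?D \<Longrightarrow> dist z' z < d
      \<Longrightarrow> dist ((\<lambda>(z, v). P z v) z') ((\<lambda>(z, v). P z v) z) < 1"
    unfolding uniformly_continuous_on_def by (metis zero_less_one)
  obtain n :: nat where n: "n > 0" "1 / n < d"
    using \<open>d > 0\<close> by (metis nat_approx_posE of_nat_0_less_iff zero_less_Suc)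
  have "\<exists>h. unit_section S (\<lambda>x. P (k / n, x)) h" if "k \<le> n" for k
    using that
  proof (induction k)
    case 0
    then show ?case using h0 by auto
  next
    case (Suc k)
    then obtain h where "unit_section S (\<lambda>x. P (k / n, x)) h"
      by auto
    then have h: "continuous_on S h" "\<And>x. x \<in> S \<Longrightarrow> norm (h x) = 1"
        "\<And>x. x \<in> S \<Longrightarrow> P (k / n, x) (h x) = h x"
      by (auto simp: unit_section_def)
    define g where "g x = P (Suc k / n, x) (h x)" for x
    have t: "k / n \<in> {0..1::real}" "Suc k / n \<in> {0..1::real}"
      using Suc.prems n by auto
    have "g x \<noteq> 0" if "x \<in> S" for x
    proof -
      have "dist (Suc k / n) (k / n) < d"
        using n by (simp add: dist_real_def diff_divide_distrib[symmetric])
      then have "dist (g x) (h x) < 1"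
        using d[of "((k / n, x), h x)" "((Suc k / n, x), h x)"] h that t
        by (simp add: g_def dist_Pair_Pair)
      then show ?thesis
        using h(2)[OF that] by (auto simp: dist_norm)
    qed
    moreover have "continuous_on S (\<lambda>x. (\<lambda>(z, v). P z v) ((Suc k / n, x), h x))"
      by (rule continuous_on_compose2[OF contP]) (use h t in \<open>auto intro!: continuous_intros\<close>)
    then have "continuous_on S g"
      by (simp add: g_def)
    ultimately have "unit_section S (\<lambda>x. P (Suc k / n, x)) (\<lambda>x. inverse (norm (g x)) *\<^sub>R g x)"
      unfolding unit_section_def using t idem scale
      by (auto intro!: continuous_intros simp: g_def)
    then show ?case by blast
  qed
  from this[of n] show ?thesis
    using n that by auto
qed

text \<open>The hemisphere contracts to \<open>e\<close>; pulling \<open>P\<close> back along the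
  contraction joins the constant field \<open>P e\<close>, which has the constant section
  \<open>v\<close>, to \<open>P\<close> itself.\<close>

lemma unit_section_hemisphere:
  fixes e :: "'a::euclidean_space" and P :: "'a \<Rightarrow> 'v::euclidean_space \<Rightarrow> 'v"
  assumes P: "projector_field (sphere 0 1) P" and e: "norm e = 1" and v: "norm v = 1" "P e v = v"
  obtains h where "unit_section {x \<in> sphere 0 1. 0 \<le> e \<bullet> x} P h"
proof -
  let ?D = "{x \<in> sphere (0::'a) 1. 0 \<le> e \<bullet> x}"
  \<comment> \<open>The segment from \<open>e\<close> to a point of the hemisphere. Its component
    along \<open>e\<close> is positive before time 1, so it avoids 0 and can be normalized.\<close>
  define y where "y z = (1 - fst z) *\<^sub>R e + fst z *\<^sub>R snd z" for z :: "real \<times> 'a"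
  have y0: "y z \<noteq> 0" if "z \<in> {0..1} \<times> ?D" for z
  proof (cases "fst z = 1")
    case False
    have "e \<bullet> e = 1"
      using e by (simp add: norm_eq_1)
    then have "e \<bullet> y z = (1 - fst z) + fst z * (e \<bullet> snd z)"
      by (simp add: y_def inner_add_right)
    also have "\<dots> > 0"
      using that False by (intro add_pos_nonneg) auto
    finally show ?thesis by auto
  qed (use that in \<open>auto simp: y_def\<close>)
  have "projector_field ({0..1} \<times> ?D) (\<lambda>z. P (y z /\<^sub>R norm (y z)))"
  proof (rule projector_field_pullback[OF P])
    show "continuous_on ({0..1} \<times> ?D) (\<lambda>z. y z /\<^sub>R norm (y z))"
      using y0 by (auto simp: y_def intro!: continuous_intros)
  qed (use y0 in auto)
  moreover have "compact ?D"
    by (intro closed_Int_compact[of "{x. 0 \<le> e \<bullet> x}" "sphere 0 1", simplified Int_def, simplified, THEN back_subst[of compact]])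
       (auto intro!: closed_halfspace_ge)
  moreover have "unit_section ?D (\<lambda>x. P (y (0, x) /\<^sub>R norm (y (0, x)))) (\<lambda>_. v)"
    using v e by (simp add: unit_section_def y_def)
  ultimately obtain h where h: "unit_section ?D (\<lambda>x. P (y (1, x) /\<^sub>R norm (y (1, x)))) h"
    by (elim unit_section_homotopy)
  then have "unit_section ?D P h"
    by (auto simp: unit_section_def y_def)
  then show ?thesis ..
qed

text \<open>Clutching: sections over the two hemispheres glue once they agree on the equator.
  \<open>transition\<close> isolates that correction, which is made differently for real and for
  complex lines.\<close>

lemma unit_section_sphere:
  fixes e :: "'a::euclidean_space" and P :: "'a \<Rightarrow> 'v::euclidean_space \<Rightarrow> 'v"
  assumes P: "projector_field (sphere 0 1) P" and e: "norm e = 1"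
    and nz: "\<And>x. x \<in> sphere 0 1 \<Longrightarrow> \<exists>v. norm v = 1 \<and> P x v = v"
    and transition: "\<And>g h. unit_section {x \<in> sphere 0 1. 0 \<le> e \<bullet> x} P g \<Longrightarrow>
      unit_section {x \<in> sphere 0 1. e \<bullet> x \<le> 0} P h \<Longrightarrow>
      \<exists>h'. unit_section {x \<in> sphere 0 1. e \<bullet> x \<le> 0} P h' \<and> (\<forall>x\<in>sphere 0 1. e \<bullet> x = 0 \<longrightarrow> h' x = g x)"
  obtains h where "unit_section (sphere 0 1) P h"
proof -
  obtain g where g: "unit_section {x \<in> sphere 0 1. 0 \<le> e \<bullet> x} P g"
    using unit_section_hemisphere[OF P e] nz[of e] e by auto
  obtain h where "unit_section {x \<in> sphere 0 1. 0 \<le> (- e) \<bullet> x} P h"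
    using unit_section_hemisphere[OF P, of "- e"] nz[of "- e"] e by auto
  then have "unit_section {x \<in> sphere 0 1. e \<bullet> x \<le> 0} P h"
    by simp
  with transition[OF g] obtain h' where h': "unit_section {x \<in> sphere 0 1. e \<bullet> x \<le> 0} P h'"
      "\<And>x. x \<in> sphere 0 1 \<Longrightarrow> e \<bullet> x = 0 \<Longrightarrow> h' x = g x"
    by blast
  have "continuous_on (sphere 0 1) (\<lambda>x. if e \<bullet> x \<le> 0 then h' x else g x)"
    using g h' by (intro continuous_on_cases_le continuous_intros) (auto simp: unit_section_def)
  then have "unit_section (sphere 0 1) P (\<lambda>x. if e \<bullet> x \<le> 0 then h' x else g x)"
    using g h' by (auto simp: unit_section_def)
  then show ?thesis ..
qed

text \<open>The equator is the relative frontier of the flat disc that a hyperplane cuts from the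
  ball. The disc has dimension at least 3, so the equator is a sphere of dimension at least
  2.\<close>

lemma equator:
  fixes e :: "'a::euclidean_space"
  assumes "4 \<le> DIM('a)" "norm e = 1"
  shows simply_connected_equator: "simply_connected {x \<in> sphere 0 1. e \<bullet> x = 0}"
    and locally_path_connected_equator: "locally path_connected {x \<in> sphere 0 1. e \<bullet> x = 0}"
proof -
  let ?C = "ball (0::'a) 1 \<inter> {x. e \<bullet> x = 0}"
  have aff: "affine {x. e \<bullet> x = 0}"
    by (rule affine_hyperplane)
  have ne: "interior (ball 0 1) \<inter> {x. e \<bullet> x = 0} \<noteq> {}"
    by (auto simp: Int_def intro!: exI[of _ 0])
  have "closure ?C = closure (ball 0 1) \<inter> {x. e \<bullet> x = 0}"
    by (rule convex_affine_closure_Int) (use aff ne in \<open>auto simp: rel_interior_open\<close>)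
  moreover have "rel_interior ?C = interior (ball 0 1) \<inter> {x. e \<bullet> x = 0}"
    by (rule rel_interior_convex_Int_affine) (use aff ne in auto)
  ultimately have fr: "rel_frontier ?C = {x \<in> sphere 0 1. e \<bullet> x = 0}"
    by (auto simp: rel_frontier_def)
  have "aff_dim ?C = aff_dim {x. e \<bullet> x = 0}"
    using aff_dim_convex_Int_open[of "{x. e \<bullet> x = 0}" "ball 0 1"] aff ne
    by (auto simp: Int_commute affine_imp_convex)
  then have d: "aff_dim ?C = int DIM('a) - 1"
    using assms by (subst (asm) aff_dim_hyperplane) auto
  have c: "convex ?C" "bounded ?C"
    using aff by (auto intro: convex_Int affine_imp_convex bounded_Int)
  then show "simply_connected {x \<in> sphere 0 1. e \<bullet> x = 0}"
    using simply_connected_sphere_gen[of ?C] d assms unfolding fr by auto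
  show "locally path_connected {x \<in> sphere 0 1. e \<bullet> x = 0}"
    using locally_path_connected_sphere_gen[of ?C] c unfolding fr by auto
qed

text \<open>The coefficient of \<open>g\<close> with respect to \<open>f\<close> is continuous with
  values in \<open>{1, -1}\<close>, hence constant on a connected set.\<close>

lemma eq_or_eq_uminus_constant:
  fixes f g :: "'a::topological_space \<Rightarrow> 'v::euclidean_space"
  assumes S: "connected S" and fg: "continuous_on S f" "continuous_on S g"
    and nz: "\<And>x. x \<in> S \<Longrightarrow> f x \<noteq> 0"
    and pm: "\<And>x. x \<in> S \<Longrightarrow> g x = f x \<or> g x = - f x"
  shows "(\<forall>x\<in>S. g x = f x) \<or> (\<forall>x\<in>S. g x = - f x)"
proof -
  define r where "r x = (f x \<bullet> g x) / (f x \<bullet> f x)" for x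
  have r: "g x = r x *\<^sub>R f x" "r x \<in> {1, -1}" if "x \<in> S" for x
    using pm[OF that] nz[OF that] by (auto simp: r_def)
  have "continuous_on S r"
    unfolding r_def using fg nz by (auto intro!: continuous_intros)
  moreover have "finite (r ` S)"
    by (rule finite_subset[of _ "{1, -1}"]) (use r in auto)
  ultimately have "r constant_on S"
    using S by (intro continuous_finite_range_constant)
  then obtain c where "\<And>x. x \<in> S \<Longrightarrow> r x = c"
    by (auto simp: constant_on_def)
  then show ?thesis
    using r by (cases "S = {}") fastforce+
qed

section \<open>Lifting to the double cover of projective space\<close>

text \<open>The choice is harmless, since \<open>(x \<bullet> v) *\<^sub>R x\<close> does not change
  under \<open>x\<close> to \<open>- x\<close>. For a unit \<open>x\<close> this is the orthogonal
  projection onto the line through \<open>x\<close>.\<close>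

definition line_proj :: "'b::euclidean_space set \<Rightarrow> 'b \<Rightarrow> 'b" where
  "line_proj l v = (let x = SOME x. x \<in> l in (x \<bullet> v) *\<^sub>R x)"

lemma line_proj_antipodal_proj [simp]: "line_proj (antipodal_proj x) v = (x \<bullet> v) *\<^sub>R x"
proof -
  have "(SOME y. y \<in> antipodal_proj x) \<in> antipodal_proj x"
    by (rule someI[of _ x]) (simp add: antipodal_proj_def)
  then show ?thesis
    by (auto simp: line_proj_def antipodal_proj_def)
qed

lemma topspace_unit_sphere [simp]: "topspace unit_sphere = sphere 0 1"
  by (simp add: unit_sphere_def)

lemma topspace_real_projective_space [simp]:
  "topspace real_projective_space = antipodal_proj ` sphere 0 1"
  by (simp add: real_projective_space_def)

lemma continuous_map_line_proj:
  "continuous_map real_projective_space euclidean (\<lambda>l. line_proj l v)"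
proof (rule continuous_compose_quotient_map)
  show "quotient_map unit_sphere real_projective_space antipodal_proj"
    unfolding real_projective_space_def by (rule quotient_map_quotient_topology)
  show "continuous_map unit_sphere euclidean ((\<lambda>l. line_proj l v) \<circ> antipodal_proj)"
    by (auto simp: unit_sphere_def o_def intro!: continuous_intros)
qed

lemma continuous_map_real_projective_spaceD:
  fixes K :: "'a \<Rightarrow> 'b::euclidean_space set"
  assumes "continuous_map X real_projective_space K" "x \<in> topspace X"
  shows "\<exists>y. norm y = 1 \<and> K x = antipodal_proj y"
proof -
  have "K x \<in> topspace real_projective_space"
    using continuous_map_image_subset_topspace[OF assms(1)] assms(2) by blast
  then show ?thesis
    by auto
qed

lemma projector_field_line_proj:
  fixes K :: "'a::metric_space \<Rightarrow> 'b::euclidean_space set"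
  assumes K: "continuous_map (top_of_set S) real_projective_space K"
  shows "projector_field S (\<lambda>x. line_proj (K x))"
proof -
  \<comment> \<open>Linearity in \<open>v\<close> reduces joint continuity to that of the finitely
    many maps \<open>line_proj (K x) b\<close>.\<close>
  have 1: "line_proj (K x) v = (\<Sum>b\<in>Basis. (v \<bullet> b) *\<^sub>R line_proj (K x) b)" if x: "x \<in> S" for x v
  proof -
    obtain y where "K x = antipodal_proj y"
      using continuous_map_real_projective_spaceD[OF K, of x] x by auto
    moreover have "y \<bullet> v = (\<Sum>b\<in>Basis. (v \<bullet> b) * (y \<bullet> b))"
      by (subst euclidean_inner) (simp add: mult.commute)
    ultimately show ?thesis
      by (simp add: scaleR_sum_left)
  qed
  have "continuous_on S (\<lambda>x. line_proj (K x) b)" for b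
    using continuous_map_compose[OF K continuous_map_line_proj[of b]] by (simp add: o_def)
  then have "continuous_on (S \<times> sphere 0 1) (\<lambda>z. \<Sum>b\<in>Basis. (snd z \<bullet> b) *\<^sub>R line_proj (K (fst z)) b)"
    by (intro continuous_intros continuous_on_compose2[of S "\<lambda>x. line_proj (K x) _" _ fst]) auto
  then have "continuous_on (S \<times> sphere 0 1) (\<lambda>z. line_proj (K (fst z)) (snd z))"
    by (rule continuous_on_eq) (rule 1[symmetric], auto)
  moreover have "line_proj (K x) (line_proj (K x) v) = line_proj (K x) v
      \<and> line_proj (K x) (c *\<^sub>R v) = c *\<^sub>R line_proj (K x) v" if x: "x \<in> S" for x c v
  proof -
    obtain y where "norm y = 1" "K x = antipodal_proj y"
      using continuous_map_real_projective_spaceD[OF K, of x] x by auto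
    then show ?thesis
      by (simp add: norm_eq_1)
  qed
  ultimately show ?thesis
    by (auto simp: projector_field_def case_prod_unfold)
qed

section \<open>Lifting maps and homotopies from projective space\<close>

lemma line_proj_eq_self:
  assumes "norm y = 1" "norm v = 1" "line_proj (antipodal_proj y) v = v"
  shows "antipodal_proj v = antipodal_proj y"
proof -
  have v: "(y \<bullet> v) *\<^sub>R y = v"
    using assms by simp
  then have "\<bar>y \<bullet> v\<bar> = 1"
    using assms by (metis mult.right_neutral norm_scaleR)
  then show ?thesis
    using v by (auto simp: antipodal_proj_eq_iff abs_if split: if_splits)
qed

lemma unit_section_line_proj:
  assumes K: "continuous_map (top_of_set S) real_projective_space K"
    and h: "unit_section S (\<lambda>x. line_proj (K x)) h" and x: "x \<in> S"
  shows "antipodal_proj (h x) = K x"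
proof -
  obtain y where "norm y = 1" "K x = antipodal_proj y"
    using continuous_map_real_projective_spaceD[OF K, of x] x by auto
  then show ?thesis
    using line_proj_eq_self[of y "h x"] h x by (auto simp: unit_section_def)
qed

text \<open>A unit section of the family of lines \<open>K\<close> is a lift of \<open>K\<close>.
  Two sections differ by a single sign on the connected equator, so one of \<open>h\<close> and
  \<open>- h\<close> glues to \<open>g\<close>.\<close>

lemma sphere_lift_real_projective_space:
  fixes K :: "'a::euclidean_space \<Rightarrow> 'b::euclidean_space set"
  assumes dim: "4 \<le> DIM('a)" and K: "continuous_map unit_sphere real_projective_space K"
  obtains F where "continuous_on (sphere 0 1) F"
    "\<And>x. norm x = 1 \<Longrightarrow> norm (F x) = 1 \<and> antipodal_proj (F x) = K x"
proof -
  let ?P = "\<lambda>x. line_proj (K x)"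
  have K': "continuous_map (top_of_set (sphere 0 1)) real_projective_space K"
    using K by (simp add: unit_sphere_def)
  obtain e :: 'a where e: "e \<in> Basis"
    using nonempty_Basis by blast
  obtain h where h: "unit_section (sphere 0 1) ?P h"
  proof (rule unit_section_sphere)
    show "projector_field (sphere 0 1) ?P"
      using K' by (rule projector_field_line_proj)
    show "norm e = 1"
      using e by simp
    show "\<exists>v. norm v = 1 \<and> ?P x v = v" if x: "x \<in> sphere 0 1" for x
    proof -
      obtain y where "norm y = 1" "K x = antipodal_proj y"
        using continuous_map_real_projective_spaceD[OF K', of x] x by auto
      then show ?thesis
        by (intro exI[of _ y]) (simp add: norm_eq_1)
    qed
    fix g h
    let ?E = "{x \<in> sphere 0 1. e \<bullet> x = 0}"
    assume g: "unit_section {x \<in> sphere 0 1. 0 \<le> e \<bullet> x} ?P g"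
      and h: "unit_section {x \<in> sphere 0 1. e \<bullet> x \<le> 0} ?P h"
    have gE: "unit_section ?E ?P g" and hE: "unit_section ?E ?P h"
      by (rule unit_section_subset[OF g] unit_section_subset[OF h]; auto)+
    have KE: "continuous_map (top_of_set ?E) real_projective_space K"
      by (rule continuous_map_from_subtopology_mono[OF K']) auto
    have "(\<forall>x\<in>?E. g x = h x) \<or> (\<forall>x\<in>?E. g x = - h x)"
    proof (rule eq_or_eq_uminus_constant)
      show "connected ?E"
        using simply_connected_equator[OF dim] e by (simp add: simply_connected_imp_connected)
      show "g x = h x \<or> g x = - h x" if "x \<in> ?E" for x
      proof -
        have "antipodal_proj (g x) = K x" "antipodal_proj (h x) = K x"
          using unit_section_line_proj[OF KE gE that] unit_section_line_proj[OF KE hE that] by auto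
        then show ?thesis
          by (metis antipodal_proj_eq_iff)
      qed
    qed (use gE hE in \<open>auto simp: unit_section_def\<close>)
    moreover have "?P x (- h x) = - h x" if "x \<in> sphere 0 1" "?P x (h x) = h x" for x
    proof -
      have "?P x ((- 1) *\<^sub>R h x) = (- 1) *\<^sub>R ?P x (h x)"
        using projector_field_line_proj[OF K'] that(1) unfolding projector_field_def by blast
      then show ?thesis
        using that(2) by simp
    qed
    then have "unit_section {x \<in> sphere 0 1. e \<bullet> x \<le> 0} ?P (\<lambda>x. - h x)"
      using h by (auto simp: unit_section_def intro!: continuous_intros)
    ultimately show "\<exists>h'. unit_section {x \<in> sphere 0 1. e \<bullet> x \<le> 0} ?P h' \<and>
        (\<forall>x\<in>sphere 0 1. e \<bullet> x = 0 \<longrightarrow> h' x = g x)"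
      using h by (elim disjE) (rule exI[of _ h] exI[of _ "\<lambda>x. - h x"]; simp)+
  qed
  then show ?thesis
    using that[of h] unit_section_line_proj[OF K' h] by (auto simp: unit_section_def)
qed

text \<open>Transport yields a section at the final stage only. With the time \<open>t\<close> made
  part of the base and \<open>K (s * t, x)\<close> as the field at stage \<open>s\<close>, that
  final section lives over the whole cylinder.\<close>

lemma homotopy_lift_real_projective_space:
  fixes K :: "real \<times> 'a::metric_space \<Rightarrow> 'b::euclidean_space set"
  assumes S: "compact S" "connected S"
    and K: "continuous_map (top_of_set ({0..1} \<times> S)) real_projective_space K"
    and F: "continuous_on S F" "\<And>x. x \<in> S \<Longrightarrow> norm (F x) = 1"
      "\<And>x. x \<in> S \<Longrightarrow> antipodal_proj (F x) = K (0, x)"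
  obtains L where "continuous_on ({0..1} \<times> S) L"
    "\<And>z. z \<in> {0..1} \<times> S \<Longrightarrow> norm (L z) = 1"
    "\<And>z. z \<in> {0..1} \<times> S \<Longrightarrow> antipodal_proj (L z) = K z"
    "\<And>x. x \<in> S \<Longrightarrow> L (0, x) = F x"
proof -
  let ?I = "{0..1::real}"
  let ?r = "\<lambda>z::real \<times> real \<times> 'a. (fst z * fst (snd z), snd (snd z))"
  have "projector_field (?I \<times> ?I \<times> S) (\<lambda>z. line_proj (K (?r z)))"
    by (rule projector_field_pullback[OF projector_field_line_proj[OF K]])
       (auto intro!: continuous_intros mult_le_one)
  moreover have "compact (?I \<times> S)"
    using S by (intro compact_Times) auto
  moreover have "unit_section (?I \<times> S) (\<lambda>z. line_proj (K (?r (0, z)))) (\<lambda>z. F (snd z))"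
    using F by (auto simp: unit_section_def norm_eq_1 simp flip: F(3)
      intro!: continuous_on_compose2[OF F(1)] continuous_intros)
  ultimately obtain L where "unit_section (?I \<times> S) (\<lambda>z. line_proj (K (?r (1, z)))) L"
    by (elim unit_section_homotopy)
  then have L: "unit_section (?I \<times> S) (\<lambda>z. line_proj (K z)) L"
    by simp
  have KL: "antipodal_proj (L z) = K z" if "z \<in> ?I \<times> S" for z
    using unit_section_line_proj[OF K L that] .
  have L': "continuous_on (?I \<times> S) L" "\<And>z. z \<in> ?I \<times> S \<Longrightarrow> norm (L z) = 1"
    using L by (auto simp: unit_section_def)
  \<comment> \<open>Transport need not return \<open>F\<close> at time 0, but only a lift of the
    same lines; a global sign repairs this.\<close>
  have "(\<forall>x\<in>S. F x = L (0, x)) \<or> (\<forall>x\<in>S. F x = - L (0, x))"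
  proof (rule eq_or_eq_uminus_constant[OF S(2) _ F(1)])
    show "continuous_on S (\<lambda>x. L (0, x))"
      by (rule continuous_on_compose2[OF L'(1)]) (auto intro!: continuous_intros)
    show "L (0, x) \<noteq> 0" if "x \<in> S" for x
      using L'(2)[of "(0, x)"] that by auto
    show "F x = L (0, x) \<or> F x = - L (0, x)" if "x \<in> S" for x
      using F(3)[OF that] KL[of "(0, x)"] that by (simp add: antipodal_proj_eq_iff[symmetric])
  qed
  then show ?thesis
  proof
    assume "\<forall>x\<in>S. F x = L (0, x)"
    then show ?thesis
      using that[of L] L' KL by auto
  next
    assume "\<forall>x\<in>S. F x = - L (0, x)"
    moreover have "antipodal_proj (- L z) = antipodal_proj (L z)" for z
      by (simp add: antipodal_proj_eq_iff)
    ultimately show ?thesis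
      using that[of "\<lambda>z. - L z"] L' KL by (auto intro!: continuous_intros)
  qed
qed

section \<open>Lifting through the Hopf map\<close>

definition hopf :: "complex \<times> complex \<Rightarrow> real^3" where
  "hopf v = vector [2 * Re (fst v * cnj (snd v)), 2 * Im (fst v * cnj (snd v)),
     (norm (fst v))\<^sup>2 - (norm (snd v))\<^sup>2]"

definition phase :: "complex \<Rightarrow> complex \<times> complex \<Rightarrow> complex \<times> complex" where
  "phase u v = (u * fst v, u * snd v)"

text \<open>Antilinear with square \<open>-1\<close>; under \<open>hopf\<close> it covers the
  antipodal map of the 2-sphere.\<close>

definition anti :: "complex \<times> complex \<Rightarrow> complex \<times> complex" where
  "anti v = (- cnj (snd v), cnj (fst v))"

text \<open>The value of \<open>2 * (z * cnj w)\<close> for a unit vector \<open>(z, w)\<close> over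
  a unit \<open>p\<close>; half of it is the upper right entry of the projector below.\<close>

definition vec_coord :: "real^3 \<Rightarrow> complex" where
  "vec_coord p = of_real (p $ 1) + \<i> * of_real (p $ 2)"

text \<open>The projector \<open>(1 + p \<cdot> \<sigma>) / 2\<close> with the Pauli matrices \<open>\<sigma>\<close>; for \<open>norm p = 1\<close> its image is the
  complex line over \<open>p\<close>.\<close>

definition hopf_proj :: "real^3 \<Rightarrow> complex \<times> complex \<Rightarrow> complex \<times> complex" where
  "hopf_proj p v =
     ((of_real (1 + p $ 3) * fst v + vec_coord p * snd v) / 2,
      (cnj (vec_coord p) * fst v + of_real (1 - p $ 3) * snd v) / 2)"

section \<open>Algebra of the Hopf map and its projectors\<close>

lemma norm_pair_eq_1: "norm (v :: complex \<times> complex) = 1 \<longleftrightarrow> (norm (fst v))\<^sup>2 + (norm (snd v))\<^sup>2 = 1"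
  by (simp add: norm_prod_def)

lemma norm_pair_eq_1_cnj:
  "norm (v :: complex \<times> complex) = 1 \<Longrightarrow> fst v * cnj (fst v) + snd v * cnj (snd v) = 1"
  by (metis norm_pair_eq_1 complex_norm_square of_real_add of_real_1)

lemma norm_vec3_eq_1: "norm (p :: real^3) = 1 \<longleftrightarrow> (p $ 1)\<^sup>2 + (p $ 2)\<^sup>2 + (p $ 3)\<^sup>2 = 1"
  by (simp add: norm_eq_1 inner_vec_def sum_3 power2_eq_square)

lemma vec_coord_norm:
  assumes "norm p = 1"
  shows "vec_coord p * cnj (vec_coord p) = 1 - of_real (p $ 3) * of_real (p $ 3)"
  using assms by (simp add: norm_vec3_eq_1 vec_coord_def complex_eq_iff power2_eq_square algebra_simps)

text \<open>The matrix has trace 1, and \<open>vec_coord_norm\<close> says that its determinant is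
  0; so Cayley-Hamilton makes it idempotent.\<close>

lemma hopf_proj_idem:
  assumes "norm p = 1"
  shows "hopf_proj p (hopf_proj p v) = hopf_proj p v"
proof -
  let ?r = "of_real (p $ 3) :: complex"
  have "vec_coord p * cnj (vec_coord p) = 1 - ?r * ?r"
    by (rule vec_coord_norm[OF assms])
  then show ?thesis
    unfolding hopf_proj_def prod_eq_iff fst_conv snd_conv of_real_add of_real_diff of_real_1
    by (intro conjI; simp add: field_simps; algebra)
qed

lemma hopf_proj_phase: "hopf_proj p (phase u v) = phase u (hopf_proj p v)"
  by (simp add: hopf_proj_def phase_def algebra_simps add_divide_distrib)

lemma phase_of_real: "phase (of_real c) v = c *\<^sub>R v"
  by (simp add: phase_def prod_eq_iff scaleR_conv_of_real)

lemma norm_phase: "norm (phase u v) = norm u * norm v"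
  by (simp add: phase_def norm_prod_def norm_mult power_mult_distrib real_sqrt_mult
      flip: distrib_left)

lemma hopf_phase: "norm u = 1 \<Longrightarrow> hopf (phase u v) = hopf v"
proof -
  assume u: "norm u = 1"
  then have "u * cnj u = 1"
    by (simp add: complex_norm_square[symmetric])
  then have *: "u * fst v * cnj (u * snd v) = fst v * cnj (snd v)"
    by (simp add: ac_simps)
  show ?thesis
    unfolding hopf_def phase_def fst_conv snd_conv * by (simp add: u norm_mult)
qed

lemma continuous_on_phase [continuous_intros]:
  "continuous_on S u \<Longrightarrow> continuous_on S f \<Longrightarrow> continuous_on S (\<lambda>x. phase (u x) (f x))"
  unfolding phase_def by (intro continuous_intros)

lemma continuous_on_anti [continuous_intros]:
  "continuous_on S f \<Longrightarrow> continuous_on S (\<lambda>x. anti (f x))"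
  unfolding anti_def by (intro continuous_intros)

lemma continuous_on_hopf [continuous_intros]:
  assumes "continuous_on S f"
  shows "continuous_on S (\<lambda>x. hopf (f x))"
proof -
  have *: "(\<lambda>x. hopf (f x)) = (\<lambda>x. (2 * Re (fst (f x) * cnj (snd (f x)))) *\<^sub>R axis 1 1
      + (2 * Im (fst (f x) * cnj (snd (f x)))) *\<^sub>R axis 2 1
      + ((norm (fst (f x)))\<^sup>2 - (norm (snd (f x)))\<^sup>2) *\<^sub>R axis 3 1)"
    by (auto simp: hopf_def vec_eq_iff forall_3 axis_def)
  show ?thesis
    unfolding * by (intro continuous_intros assms)
qed

lemma anti_anti: "anti (anti v) = - v"
  by (simp add: anti_def prod_eq_iff)

lemma anti_phase: "anti (phase u v) = phase (cnj u) (anti v)"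
  by (simp add: anti_def phase_def)

lemma norm_anti: "norm (anti v) = norm v"
  by (simp add: anti_def norm_prod_def)

lemma hopf_anti: "hopf (anti v) = - hopf v"
  by (simp add: hopf_def anti_def vec_eq_iff forall_3 algebra_simps)

lemma hopf_uminus: "hopf (- v) = hopf v"
  by (simp add: hopf_def)

lemma norm_hopf: "norm v = 1 \<Longrightarrow> norm (hopf v) = 1"
proof -
  assume "norm v = 1"
  then have 1: "(norm (fst v))\<^sup>2 + (norm (snd v))\<^sup>2 = 1"
    by (simp add: norm_pair_eq_1)
  have "(2 * Re (fst v * cnj (snd v)))\<^sup>2 + (2 * Im (fst v * cnj (snd v)))\<^sup>2
      = 4 * (norm (fst v * cnj (snd v)))\<^sup>2"
    unfolding cmod_power2 by (simp only: power_mult_distrib distrib_left) simp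
  also have "\<dots> = 4 * ((norm (fst v))\<^sup>2 * (norm (snd v))\<^sup>2)"
    by (simp add: norm_mult power_mult_distrib)
  finally have "(2 * Re (fst v * cnj (snd v)))\<^sup>2 + (2 * Im (fst v * cnj (snd v)))\<^sup>2
      + ((norm (fst v))\<^sup>2 - (norm (snd v))\<^sup>2)\<^sup>2 = ((norm (fst v))\<^sup>2 + (norm (snd v))\<^sup>2)\<^sup>2"
    by (simp add: power2_eq_square algebra_simps)
  then show ?thesis
    using 1 by (simp add: norm_vec3_eq_1 hopf_def)
qed

text \<open>A rank one Hermitian projector fixing the unit vector \<open>v\<close> is
  \<open>v v*\<close>, and the entries of this matrix determine the coordinates of
  \<open>hopf v\<close>.\<close>

lemma hopf_eq_of_hopf_proj:
  assumes p: "norm p = 1" and v: "norm v = 1" and pv: "hopf_proj p v = v"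
  shows "hopf v = p"
proof -
  obtain z w where zw: "v = (z, w)"
    by fastforce
  define c r where "c = vec_coord p" and "r = (of_real (p $ 3) :: complex)"
  have cd: "c * cnj c = 1 - r * r"
    using vec_coord_norm[OF p] by (simp add: c_def r_def)
  have e1: "(1 + r) * z + c * w = 2 * z" and e2: "cnj c * z + (1 - r) * w = 2 * w"
    using pv by (auto simp: hopf_proj_def zw c_def r_def)
  \<comment> \<open>With the conjugate equations added, \<open>z\<close>, \<open>w\<close> and their
    conjugates can be treated as four unknowns of a polynomial system.\<close>
  have e3: "(1 + r) * cnj z + cnj c * cnj w = 2 * cnj z" and e4: "c * cnj z + (1 - r) * cnj w = 2 * cnj w"
    using arg_cong[OF e1, of cnj] arg_cong[OF e2, of cnj] by (auto simp: r_def)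
  have n: "z * cnj z + w * cnj w = 1"
    using norm_pair_eq_1_cnj[OF v] by (auto simp: zw)
  have A: "2 * (z * cnj w) = c"
    using e1 e4 n by algebra
  then have A': "2 * (cnj z * w) = cnj c"
    by (metis complex_cnj_cnj complex_cnj_mult complex_cnj_numeral)
  have B: "z * cnj z - w * cnj w = r"
    using e1 e2 e3 e4 n A A' cd by algebra
  have "2 * Re (z * cnj w) = p $ 1" "2 * Im (z * cnj w) = p $ 2"
    using arg_cong[OF A, of Re] arg_cong[OF A, of Im] by (auto simp: c_def vec_coord_def)
  moreover have "(norm z)\<^sup>2 - (norm w)\<^sup>2 = p $ 3"
    using arg_cong[OF B, of Re] unfolding cmod_power2 by (simp add: r_def power2_eq_square)
  ultimately show ?thesis
    by (simp add: hopf_def zw vec_eq_iff forall_3)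
qed

lemma hopf_proj_fixed_exists:
  assumes "norm p = 1"
  shows "\<exists>v. norm v = 1 \<and> hopf_proj p v = v"
proof -
  \<comment> \<open>A basis vector whose diagonal entry in the projector is nonzero:
    \<open>1 + p $ 3\<close>, or \<open>1 - p $ 3\<close> at the south pole, up to the factor
    1/2.\<close>
  define b :: "complex \<times> complex" where "b = (if p $ 3 = -1 then (0, 1) else (1, 0))"
  define u where "u = hopf_proj p b"
  have "u \<noteq> 0"
  proof
    assume "u = 0"
    then have "complex_of_real (1 + p $ 3) = 0 \<or> complex_of_real (1 - p $ 3) = 0 \<and> p $ 3 = -1"
      "p $ 3 \<noteq> -1 \<or> complex_of_real (1 - p $ 3) = 0"
      by (auto simp: u_def b_def hopf_proj_def zero_prod_def split: if_splits)
    then show False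
      by (cases "p $ 3 = -1") (auto simp: complex_eq_iff)
  qed
  moreover have "hopf_proj p (c *\<^sub>R u) = c *\<^sub>R u" for c
    using hopf_proj_idem[OF assms, of b] by (simp add: hopf_proj_phase u_def flip: phase_of_real)
  ultimately show ?thesis
    by (intro exI[of _ "u /\<^sub>R norm u"]) auto
qed

text \<open>The Hermitian product of \<open>v'\<close> with \<open>v\<close>; it recovers
  \<open>u\<close> from \<open>v' = phase u v\<close> when \<open>v\<close> is a unit
  vector.\<close>

definition hopf_quot :: "complex \<times> complex \<Rightarrow> complex \<times> complex \<Rightarrow> complex" where
  "hopf_quot v v' = fst v' * cnj (fst v) + snd v' * cnj (snd v)"

text \<open>Equal Hopf images of unit vectors mean \<open>v v* = v' v'*\<close>. Then
  \<open>v' = v' (v'* v') = v (v* v')\<close>, and the last scalar is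
  \<open>hopf_quot v v'\<close>.\<close>

lemma hopf_fiber:
  assumes v: "norm v = 1" "norm v' = 1" and eq: "hopf v = hopf v'"
  shows "v' = phase (hopf_quot v v') v" "norm (hopf_quot v v') = 1"
proof -
  obtain z w z' w' where zw: "v = (z, w)" "v' = (z', w')"
    by fastforce
  have n: "z * cnj z + w * cnj w = 1" "z' * cnj z' + w' * cnj w' = 1"
    using norm_pair_eq_1_cnj[OF v(1)] norm_pair_eq_1_cnj[OF v(2)] by (auto simp: zw)
  have "z * cnj w = z' * cnj w'"
    using eq by (auto simp: hopf_def zw vec_eq_iff forall_3 complex_eq_iff)
  then have e: "z * cnj w = z' * cnj w'" "w * cnj z = w' * cnj z'"
    by (simp, metis complex_cnj_cnj complex_cnj_mult mult.commute)
  have "(norm z)\<^sup>2 - (norm w)\<^sup>2 = (norm z')\<^sup>2 - (norm w')\<^sup>2"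
    using eq by (simp add: hopf_def zw vec_eq_iff forall_3)
  then have d: "z * cnj z - w * cnj w = z' * cnj z' - w' * cnj w'"
    unfolding complex_norm_square[symmetric] by (metis of_real_diff)
  have "z * cnj z = z' * cnj z'" "w * cnj w = w' * cnj w'"
    using n d by algebra+
  with e n have "z' = (z' * cnj z + w' * cnj w) * z" "w' = (z' * cnj z + w' * cnj w) * w"
    by algebra+
  then show "v' = phase (hopf_quot v v') v"
    by (simp add: phase_def hopf_quot_def zw)
  then show "norm (hopf_quot v v') = 1"
    using v by (metis mult.right_neutral norm_phase)
qed

section \<open>Lifting maps of spheres through the Hopf map\<close>

lemma continuous_on_hopf_quot [continuous_intros]:
  "continuous_on S f \<Longrightarrow> continuous_on S g \<Longrightarrow> continuous_on S (\<lambda>x. hopf_quot (f x) (g x))"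
  unfolding hopf_quot_def by (intro continuous_intros)

lemma projector_field_hopf_proj: "projector_field (sphere 0 1) hopf_proj"
proof -
  have "continuous_on (sphere 0 1 \<times> sphere 0 1) (\<lambda>z. hopf_proj (fst z) (snd z))"
    unfolding hopf_proj_def vec_coord_def by (intro continuous_intros) auto
  then show ?thesis
    using hopf_proj_idem hopf_proj_phase[of _ "of_real _"]
    by (auto simp: projector_field_def case_prod_unfold phase_of_real)
qed

lemma circle_map_argument:
  fixes u :: "'a::real_normed_vector \<Rightarrow> complex"
  assumes "continuous_on S u" "\<And>x. x \<in> S \<Longrightarrow> norm (u x) = 1"
    "simply_connected S" "locally path_connected S"
  obtains \<theta> :: "'a \<Rightarrow> real" where "continuous_on S \<theta>" "\<And>x. x \<in> S \<Longrightarrow> u x = cis (\<theta> x)"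
proof -
  obtain g where g: "continuous_on S g" "\<And>x. x \<in> S \<Longrightarrow> u x = exp (g x)"
    using continuous_logarithm_on_simply_connected[OF assms(1,3,4)] assms(2)
    by (metis norm_zero zero_neq_one)
  have "u x = cis (Im (g x))" if "x \<in> S" for x
    using g(2)[OF that] assms(2)[OF that] by (simp add: exp_eq_polar norm_mult)
  then show ?thesis
    using g(1) that[of "\<lambda>x. Im (g x)"] by (auto intro!: continuous_intros)
qed

text \<open>A unit vector fixed by \<open>hopf_proj (G x)\<close> lies in the Hopf fibre over
  \<open>G x\<close>, so a unit section is a lift. On the equator two sections differ by the
  circle-valued \<open>hopf_quot\<close>.\<close>

lemma sphere_lift_hopf:
  fixes G :: "'a::euclidean_space \<Rightarrow> real^3"
  assumes dim: "4 \<le> DIM('a)" and G: "continuous_on (sphere 0 1) G" "\<And>x. norm x = 1 \<Longrightarrow> norm (G x) = 1"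
  obtains h where "continuous_on (sphere 0 1) h"
    "\<And>x. norm x = 1 \<Longrightarrow> norm (h x) = 1 \<and> hopf (h x) = G x"
proof -
  let ?P = "\<lambda>x. hopf_proj (G x)"
  have sect: "hopf (h x) = G x" if "unit_section S ?P h" "x \<in> S" "S \<subseteq> sphere 0 1" for S h x
    using that G(2) by (intro hopf_eq_of_hopf_proj) (auto simp: unit_section_def subset_iff)
  obtain e :: 'a where e: "e \<in> Basis"
    using nonempty_Basis by blast
  obtain h where h: "unit_section (sphere 0 1) ?P h"
  proof (rule unit_section_sphere)
    show "projector_field (sphere 0 1) ?P"
      by (rule projector_field_pullback[OF projector_field_hopf_proj]) (use G in auto)
    show "norm e = 1"
      using e by simp
    show "\<exists>v. norm v = 1 \<and> ?P x v = v" if "x \<in> sphere 0 1" for x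
      using hopf_proj_fixed_exists G(2) that by simp
    fix g h
    let ?E = "{x \<in> sphere 0 1. e \<bullet> x = 0}"
    assume g: "unit_section {x \<in> sphere 0 1. 0 \<le> e \<bullet> x} ?P g"
      and h: "unit_section {x \<in> sphere 0 1. e \<bullet> x \<le> 0} ?P h"
    have gE: "unit_section ?E ?P g" and hE: "unit_section ?E ?P h"
      by (rule unit_section_subset[OF g] unit_section_subset[OF h]; auto)+
    let ?u = "\<lambda>x. hopf_quot (h x) (g x)"
    have sph: "?E \<subseteq> sphere 0 1"
      by auto
    have u: "g x = phase (?u x) (h x)" "norm (?u x) = 1" if "x \<in> ?E" for x
      using hopf_fiber[of "h x" "g x"] sect[OF gE that sph] sect[OF hE that sph] gE hE that
      by (auto simp: unit_section_def)
    have "continuous_on ?E ?u"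
      using gE hE by (auto simp: unit_section_def intro!: continuous_intros)
    \<comment> \<open>The equator is simply connected, so \<open>?u\<close> has a continuous real
      argument; passing to it makes Tietze extension available.\<close>
    then obtain \<theta> where \<theta>: "continuous_on ?E \<theta>" "\<And>x. x \<in> ?E \<Longrightarrow> ?u x = cis (\<theta> x)"
      using circle_map_argument[of ?E ?u] u(2) simply_connected_equator[OF dim, of e]
        locally_path_connected_equator[OF dim, of e] e by auto
    have "?E = sphere 0 1 \<inter> {x. e \<bullet> x = 0}"
      by auto
    then have "closed ?E"
      by (simp add: closed_Int closed_hyperplane)
    then have "closedin (top_of_set UNIV) ?E"
      by simp
    with \<theta>(1) obtain \<tau> where \<tau>: "continuous_on UNIV \<tau>" "\<And>x. x \<in> ?E \<Longrightarrow> \<tau> x = \<theta> x"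
  by (rule Tietze_unbounded) blast
    \<comment> \<open>Multiplying \<open>h\<close> by the extended phase keeps it a section, as
      \<open>hopf_proj\<close> commutes with phases, and turns it into \<open>g\<close> on the
      equator.\<close>
    have "unit_section {x \<in> sphere 0 1. e \<bullet> x \<le> 0} ?P (\<lambda>x. phase (cis (\<tau> x)) (h x))"
      using h continuous_on_subset[OF \<tau>(1) subset_UNIV]
      by (auto simp: unit_section_def hopf_proj_phase norm_phase cis_conv_exp intro!: continuous_intros)
    moreover have "phase (cis (\<tau> x)) (h x) = g x" if "x \<in> ?E" for x
      using u(1) \<theta>(2) \<tau>(2) that by simp
    ultimately show "\<exists>h'. unit_section {x \<in> sphere 0 1. e \<bullet> x \<le> 0} ?P h' \<and>
        (\<forall>x\<in>sphere 0 1. e \<bullet> x = 0 \<longrightarrow> h' x = g x)"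
      by auto
  qed
  then show ?thesis
    using that[of h] sect[OF h] by (auto simp: unit_section_def)
qed

section \<open>Odd and even maps to the 2-sphere\<close>

lemma phase_phase: "phase a (phase b v) = phase (a * b) v"
  by (simp add: phase_def mult.assoc)

lemma phase_uminus: "phase a (- v) = phase (- a) v"
  by (simp add: phase_def)

lemma phase_eq_self: "phase a v = v \<Longrightarrow> norm v = 1 \<Longrightarrow> a = 1"
  by (cases "fst v = 0"; cases "snd v = 0") (auto simp: phase_def prod_eq_iff norm_pair_eq_1)

text \<open>An odd \<open>F\<close> would give an odd map \<open>u\<close> to the circle. On the
  simply connected sphere \<open>u\<close> has a real argument \<theta>, and \<theta> must agree at
  some pair of antipodes, where \<open>u (- x) = u x\<close>.\<close>

theorem no_odd_map_sphere_to_S2: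
  fixes F :: "'a::euclidean_space \<Rightarrow> real^3"
  assumes dim: "4 \<le> DIM('a)" and F: "continuous_on (sphere 0 1) F"
      "\<And>x. norm x = 1 \<Longrightarrow> norm (F x) = 1"
    and odd: "\<And>x. norm x = 1 \<Longrightarrow> F (- x) = - F x"
  shows False
proof -
  obtain h where h: "continuous_on (sphere 0 1) h"
      "\<And>x. norm x = 1 \<Longrightarrow> norm (h x) = 1 \<and> hopf (h x) = F x"
    using sphere_lift_hopf[OF dim F] by blast
  let ?S = "sphere (0::'a) 1"
  have neg: "continuous_on ?S (\<lambda>x. f (- x))" if "continuous_on ?S f" for f :: "'a \<Rightarrow> 'b::topological_space"
    by (rule continuous_on_compose2[OF that]) (auto intro!: continuous_intros)
  \<comment> \<open>Both \<open>h (- x)\<close> and \<open>anti (h x)\<close> lie over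
    \<open>- F x\<close>, so they differ by a phase.\<close>
  define u where "u x = hopf_quot (anti (h x)) (h (- x))" for x
  have u: "h (- x) = phase (u x) (anti (h x))" "norm (u x) = 1" if "norm x = 1" for x
    using hopf_fiber[of "anti (h x)" "h (- x)"] h(2)[of x] h(2)[of "- x"] odd[of x] that
    by (auto simp: norm_anti hopf_anti u_def)
  have contu: "continuous_on ?S u"
    unfolding u_def by (intro continuous_intros h(1) neg)
  obtain \<theta> where \<theta>: "continuous_on ?S \<theta>" "\<And>x. x \<in> ?S \<Longrightarrow> u x = cis (\<theta> x)"
    by (rule circle_map_argument[OF contu])
       (use u(2) dim in \<open>auto intro: simply_connected_sphere locally_path_connected_sphere\<close>)
  \<comment> \<open>The relation at \<open>x\<close> and at \<open>- x\<close>, with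
    \<open>anti\<close> antilinear of square \<open>-1\<close>, gives
    \<open>u (- x) * cnj (u x) = -1\<close>.\<close>
  have u_odd: "u (- x) = - u x" if "norm x = 1" for x
  proof -
    have "h x = phase (u (- x)) (anti (phase (u x) (anti (h x))))"
      using u(1)[of "- x"] u(1)[of x] that by simp
    also have "\<dots> = phase (- (u (- x) * cnj (u x))) (h x)"
      by (simp add: anti_phase anti_anti phase_phase phase_uminus)
    finally have "- (u (- x) * cnj (u x)) = 1"
      using phase_eq_self h(2) that by metis
    moreover have "u x * cnj (u x) = 1"
      using u(2)[OF that] by (simp flip: complex_norm_square)
    ultimately show ?thesis
      by algebra
  qed
  \<comment> \<open>An odd real function, which must vanish somewhere on a connected sphere.\<close>
  define d where "d x = \<theta> (- x) - \<theta> x" for x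
  have contd: "continuous_on ?S d"
    unfolding d_def by (intro continuous_intros \<theta>(1) neg)
  have nz: "d x \<noteq> 0" if "x \<in> ?S" for x
  proof
    assume "d x = 0"
    then have "u (- x) = u x"
      using \<theta>(2)[of x] \<theta>(2)[of "- x"] that by (simp add: d_def)
    then show False
      using u_odd[of x] u(2)[of x] that by auto
  qed
  obtain e :: 'a where e: "e \<in> Basis"
    using nonempty_Basis by blast
  have "connected (d ` ?S)"
    by (intro connected_continuous_image contd connected_sphere) (use dim in auto)
  moreover have "d e \<in> d ` ?S" "- d e \<in> d ` ?S"
    using e by (auto intro!: image_eqI[of _ _ e] image_eqI[of _ _ "- e"] simp: d_def)
  ultimately have "0 \<in> d ` ?S"
    using connectedD_interval[of "d ` ?S" "d e" "- d e" 0]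
      connectedD_interval[of "d ` ?S" "- d e" "d e" 0] by linarith
  then show False
    using nz by auto
qed

text \<open>Any lift satisfies \<open>g (- x) = phase (u x) (g x)\<close>. Multiplying
  \<open>g\<close> by half the argument of \<open>u\<close> splits this phase between the antipodes
  and leaves only a sign.\<close>

lemma even_lift_hopf:
  fixes F :: "'a::euclidean_space \<Rightarrow> real^3"
  assumes dim: "4 \<le> DIM('a)" and F: "continuous_on (sphere 0 1) F"
      "\<And>x. norm x = 1 \<Longrightarrow> norm (F x) = 1"
    and even: "\<And>x. norm x = 1 \<Longrightarrow> F (- x) = F x"
  obtains h where "continuous_on (sphere 0 1) h"
    "\<And>x. norm x = 1 \<Longrightarrow> norm (h x) = 1 \<and> hopf (h x) = F x"
    "\<And>x. norm x = 1 \<Longrightarrow> h (- x) = h x \<or> h (- x) = - h x"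
proof -
  obtain g where g: "continuous_on (sphere 0 1) g"
      "\<And>x. norm x = 1 \<Longrightarrow> norm (g x) = 1 \<and> hopf (g x) = F x"
    using sphere_lift_hopf[OF dim F] by blast
  let ?S = "sphere (0::'a) 1"
  have neg: "continuous_on ?S (\<lambda>x. f (- x))" if "continuous_on ?S f" for f :: "'a \<Rightarrow> 'b::topological_space"
    by (rule continuous_on_compose2[OF that]) (auto intro!: continuous_intros)
  define u where "u x = hopf_quot (g x) (g (- x))" for x
  have u: "g (- x) = phase (u x) (g x)" "norm (u x) = 1" if "norm x = 1" for x
    using hopf_fiber[of "g x" "g (- x)"] g(2)[of x] g(2)[of "- x"] even[of x] that
    by (auto simp: u_def)
  have contu: "continuous_on ?S u"
    unfolding u_def by (intro continuous_intros g(1) neg)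
  obtain \<theta> where \<theta>: "continuous_on ?S \<theta>" "\<And>x. x \<in> ?S \<Longrightarrow> u x = cis (\<theta> x)"
    by (rule circle_map_argument[OF contu])
       (use u(2) dim in \<open>auto intro: simply_connected_sphere locally_path_connected_sphere\<close>)
  define h where "h x = phase (cis (\<theta> x / 2)) (g x)" for x
  have "continuous_on ?S h"
    unfolding h_def cis_conv_exp by (intro continuous_intros g(1) \<theta>(1)) auto
  moreover have "norm (h x) = 1 \<and> hopf (h x) = F x" if "norm x = 1" for x
    using g(2)[OF that] by (simp add: h_def norm_phase hopf_phase)
  moreover have "h (- x) = h x \<or> h (- x) = - h x" if x: "norm x = 1" for x
  proof -
    \<comment> \<open>The remaining phase between \<open>h x\<close> and \<open>h (- x)\<close>; its
      square is \<open>u (- x) * u x = 1\<close>.\<close>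
    define c where "c = cis ((\<theta> x + \<theta> (- x)) / 2)"
    have "g x = phase (u (- x) * u x) (g x)"
      using u(1)[of "- x"] u(1)[of x] x by (simp add: phase_phase)
    then have "u (- x) * u x = 1"
      using phase_eq_self g(2) x by metis
    then have "c * c = 1"
      using \<theta>(2)[of x] \<theta>(2)[of "- x"] x by (simp add: c_def cis_mult add.commute)
    then have "c = 1 \<or> c = - 1"
      by (simp add: square_eq_1_iff)
    moreover have "cis (\<theta> (- x) / 2) * cis (\<theta> x) = c * cis (\<theta> x / 2)"
      by (simp add: c_def cis_mult add_divide_distrib add_ac)
    then have "h (- x) = phase c (h x)"
      using u(1)[OF x] \<theta>(2)[of x] x by (simp add: h_def phase_phase)
    ultimately show ?thesis
      by (auto simp: phase_def prod_eq_iff)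
  qed
  ultimately show ?thesis
    using that by blast
qed

text \<open>Each \<open>v\<close> is orthogonal to \<open>anti v\<close>, and \<open>hopf\<close> is quadratic; hence the rotation from \<open>h\<close> to
  \<open>anti \<circ> h\<close> induces a homotopy of even maps, even if \<open>h\<close> itself is odd.\<close>

lemma homotopy_uminus:
  fixes F :: "'a::euclidean_space \<Rightarrow> real^3"
  assumes dim: "4 \<le> DIM('a)" and F: "continuous_on (sphere 0 1) F"
      "\<And>x. norm x = 1 \<Longrightarrow> norm (F x) = 1"
    and s: "s = 1 \<or> s = -1" and inv: "\<And>x. norm x = 1 \<Longrightarrow> F (s *\<^sub>R x) = F x"
  obtains K :: "real \<times> 'a \<Rightarrow> real^3" where "continuous_on ({0..1} \<times> sphere 0 1) K"
    "\<And>t x. norm x = 1 \<Longrightarrow> norm (K (t, x)) = 1"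
    "\<And>x. norm x = 1 \<Longrightarrow> K (0, x) = F x" "\<And>x. norm x = 1 \<Longrightarrow> K (1, x) = - F x"
    "\<And>t x. norm x = 1 \<Longrightarrow> K (t, s *\<^sub>R x) = K (t, x)"
proof -
  obtain h where h: "continuous_on (sphere 0 1) h"
    "\<And>x. norm x = 1 \<Longrightarrow> norm (h x) = 1 \<and> hopf (h x) = F x"
    "\<And>x. norm x = 1 \<Longrightarrow> h (s *\<^sub>R x) = h x \<or> h (s *\<^sub>R x) = - h x"
  \<comment> \<open>For \<open>s = 1\<close> any lift serves. For \<open>s = -1\<close> the
    antipodal map preserves the lift up to sign, and \<open>hopf\<close> does not see the
    sign.\<close>
  proof (cases "s = 1")
    case True
    then show ?thesis
      using sphere_lift_hopf[OF dim F] that by (metis scaleR_one)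
  next
    case False
    then have "s = -1"
      using s by simp
    then show ?thesis
      using even_lift_hopf[OF dim F] inv that by (metis scaleR_minus1_left)
  qed
  define r where "r t v = cos (pi / 2 * t) *\<^sub>R v + sin (pi / 2 * t) *\<^sub>R anti v" for t v
  have norm_r: "norm (r t v) = 1" if "norm v = 1" for t v
  proof -
    have "v \<bullet> anti v = 0"
      by (simp add: anti_def inner_prod_def inner_complex_def)
    moreover have "v \<bullet> v = 1" "anti v \<bullet> anti v = 1"
      using that norm_anti[of v] by (simp_all add: norm_eq_1[symmetric])
    ultimately show ?thesis
      by (simp add: norm_eq_1 r_def inner_add_left inner_add_right inner_commute
          power2_eq_square[symmetric])
  qed
  have r_uminus: "r t (- v) = - r t v" for t v
    by (simp add: r_def anti_def prod_eq_iff)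
  show ?thesis
  proof
    have "continuous_on ({0..1} \<times> sphere 0 1) (\<lambda>z::real \<times> 'a. h (snd z))"
      by (rule continuous_on_compose2[OF h(1)]) (auto intro!: continuous_intros)
    then show "continuous_on ({0..1} \<times> sphere 0 1) (\<lambda>z. hopf (r (fst z) (h (snd z))))"
      unfolding r_def by (intro continuous_intros)
    fix t and x :: 'a assume x: "norm x = 1"
    show "norm (hopf (r (fst (t, x)) (h (snd (t, x))))) = 1"
      using norm_hopf norm_r h(2) x by simp
    show "hopf (r (fst (0, x)) (h (snd (0, x)))) = F x"
      using h(2) x by (simp add: r_def)
    show "hopf (r (fst (1, x)) (h (snd (1, x)))) = - F x"
      using h(2) x by (simp add: r_def hopf_anti)
    show "hopf (r (fst (t, s *\<^sub>R x)) (h (snd (t, s *\<^sub>R x)))) = hopf (r (fst (t, x)) (h (snd (t, x))))"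
      using h(3)[OF x] by (auto simp: r_uminus hopf_uminus)
  qed
qed

section \<open>Homotopy classes\<close>

lemma eq_uminus_iff_eq_0: "v = - v \<longleftrightarrow> v = 0" for v :: "'a::real_vector"
  by (simp add: eq_neg_iff_add_eq_0 flip: scaleR_2)

text \<open>The unit interval is compact Hausdorff, so its product with a quotient map is again a
  quotient map; hence a homotopy constant on the fibres of \<open>q\<close> descends.\<close>

lemma quotient_homotopy:
  fixes X :: "'a topology" and Z :: "'c topology" and K :: "real \<times> 'a \<Rightarrow> 'c"
  assumes q: "quotient_map X Y q"
    and K: "continuous_map (prod_topology (top_of_set {0..1}) X) Z K"
    and eq: "\<And>t x y. t \<in> {0..1} \<Longrightarrow> x \<in> topspace X \<Longrightarrow> y \<in> topspace X \<Longrightarrow> q x = q y \<Longrightarrow> K (t, x) = K (t, y)"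
    and f: "\<And>x. x \<in> topspace X \<Longrightarrow> K (0, x) = f (q x)"
    and g: "\<And>x. x \<in> topspace X \<Longrightarrow> K (1, x) = g (q x)"
  shows "homotopic_with (\<lambda>_. True) Y Z f g"
proof -
  let ?I = "top_of_set {0..1::real}"
  have qI: "quotient_map (prod_topology ?I X) (prod_topology ?I Y) (\<lambda>(t, x). (t, q x))"
  proof (rule quotient_map_prod_right[OF _ _ q])
    show "locally_compact_space ?I"
      by (intro compact_imp_locally_compact_space compact_space_subtopology) simp
    show "Hausdorff_space ?I \<or> regular_space ?I"
      by (simp add: Hausdorff_space_subtopology)
  qed
  have "K z = K z'" if "z \<in> topspace (prod_topology ?I X)" "z' \<in> topspace (prod_topology ?I X)"
    "(\<lambda>(t, x). (t, q x)) z = (\<lambda>(t, x). (t, q x)) z'" for z z'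
    using that eq[of "fst z" "snd z" "snd z'"] by (cases z; cases z') simp
  then obtain H where H: "continuous_map (prod_topology ?I Y) Z H"
      "\<And>z. z \<in> topspace (prod_topology ?I X) \<Longrightarrow> H ((\<lambda>(t, x). (t, q x)) z) = K z"
    using quotient_map_lift_exists[OF qI K] by metis
  have "q ` topspace X = topspace Y"
    using q by (rule quotient_imp_surjective_map)
  have "H (0, y) = f y \<and> H (1, y) = g y" if y: "y \<in> topspace Y" for y
  proof -
    obtain x where "x \<in> topspace X" "y = q x"
      using y \<open>q ` topspace X = topspace Y\<close> by auto
    then show ?thesis
      using H(2)[of "(0, x)"] H(2)[of "(1, x)"] f g by simp
  qed
  then show ?thesis
    using H(1) by (subst homotopic_with) auto
qed

section \<open>From lifting to bijections of homotopy classes\<close>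

lemma continuous_map_unit_sphere_iff:
  "continuous_map (top_of_set S) unit_sphere f \<longleftrightarrow> continuous_on S f \<and> (\<forall>x\<in>S. norm (f x) = 1)"
  by (auto simp: unit_sphere_def continuous_map_in_subtopology image_subset_iff Pi_iff)

lemma homotopy_classes_eq: "homotopy_classes X Y = homotopy_class X Y ` {f. continuous_map X Y f}"
  by (auto simp: homotopy_classes_def homotopy_class_def quotient_def)

lemma homotopy_class_eq_iff:
  assumes "continuous_map X Y f" "continuous_map X Y g"
  shows "homotopy_class X Y f = homotopy_class X Y g \<longleftrightarrow> homotopic_with (\<lambda>_. True) X Y f g"
  using eq_equiv_class_iff[OF equiv_homotopy_rel, of f X Y g] assms
  by (auto simp: homotopy_class_def homotopy_rel_def)

text \<open>Strict lifts on \<open>topspace X\<close> give surjectivity on classes, because total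
  functions that agree there are homotopic.\<close>

lemma bij_betw_postcomp_class:
  assumes p: "continuous_map Y Z p"
    and inj: "\<And>f g. continuous_map X Y f \<Longrightarrow> continuous_map X Y g \<Longrightarrow>
      homotopic_with (\<lambda>_. True) X Z (p \<circ> f) (p \<circ> g) \<Longrightarrow> homotopic_with (\<lambda>_. True) X Y f g"
    and surj: "\<And>f. continuous_map X Z f \<Longrightarrow> \<exists>g. continuous_map X Y g \<and> (\<forall>x\<in>topspace X. p (g x) = f x)"
  shows "bij_betw (postcomp_class X Z p) (homotopy_classes X Y) (homotopy_classes X Z)"
proof -
  have post: "postcomp_class X Z p (homotopy_class X Y f) = homotopy_class X Z (p \<circ> f)"
    and pf: "continuous_map X Z (p \<circ> f)" if "continuous_map X Y f" for f
    using postcomp_class_homotopy_class[OF p that] continuous_map_compose[OF that p] by auto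
  show ?thesis
  proof (rule bij_betw_imageI)
    show "inj_on (postcomp_class X Z p) (homotopy_classes X Y)"
      unfolding homotopy_classes_eq by (rule inj_onI, elim imageE) (simp add: post homotopy_class_eq_iff pf inj)
    show "postcomp_class X Z p ` homotopy_classes X Y = homotopy_classes X Z"
    proof
      show "postcomp_class X Z p ` homotopy_classes X Y \<subseteq> homotopy_classes X Z"
        unfolding homotopy_classes_eq by (auto simp: post pf)
      show "homotopy_classes X Z \<subseteq> postcomp_class X Z p ` homotopy_classes X Y"
      proof
        fix C assume "C \<in> homotopy_classes X Z"
        then obtain f where f: "continuous_map X Z f" "C = homotopy_class X Z f"
          unfolding homotopy_classes_eq by auto
        obtain g where g: "continuous_map X Y g" "\<And>x. x \<in> topspace X \<Longrightarrow> p (g x) = f x"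
          using surj[OF f(1)] by auto
        have "homotopic_with (\<lambda>_. True) X Z (p \<circ> g) f"
          using g pf by (intro homotopic_with_equal) auto
        then have "homotopic_with (\<lambda>_. True) X Z f (p \<circ> g)"
          by (rule homotopic_with_symD)
        then have "C = postcomp_class X Z p (homotopy_class X Y g)"
          using f g pf by (simp add: post homotopy_class_eq_iff)
        then show "C \<in> postcomp_class X Z p ` homotopy_classes X Y"
          unfolding homotopy_classes_eq using g(1) by blast
      qed
    qed
  qed
qed

text \<open>Both cases at once: \<open>X\<close> is the sphere modulo \<open>x\<close> to
  \<open>s *\<^sub>R x\<close>, so \<open>s = 1\<close> gives the sphere and \<open>s = -1\<close>
  projective space. Maps out of \<open>X\<close> become \<open>s\<close>-invariant maps out of the
  sphere.\<close>

lemma bij_betw_postcomp_double_cover: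
  fixes X :: "'c topology" and q :: "'a::euclidean_space \<Rightarrow> 'c"
  assumes dim: "4 \<le> DIM('a)" and q: "quotient_map unit_sphere X q"
    and s: "s = 1 \<or> s = -1"
    and fib: "\<And>x y. norm x = 1 \<Longrightarrow> norm y = 1 \<Longrightarrow> q x = q y \<longleftrightarrow> y = x \<or> y = s *\<^sub>R x"
  shows "bij_betw (postcomp_class X RP2 double_cover2) (homotopy_classes X S2) (homotopy_classes X RP2)"
proof (rule bij_betw_postcomp_class[OF continuous_map_antipodal_proj])
  let ?S = "sphere (0::'a) 1" and ?I = "{0..1::real}"
  have contq: "continuous_map unit_sphere X q"
    using q by (rule quotient_imp_continuous_map)
  have top: "unit_sphere = top_of_set ?S"
    by (simp add: unit_sphere_def)
  have conn: "connected ?S"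
    by (rule connected_sphere) (use dim in auto)
  have qs: "q (s *\<^sub>R x) = q x" if "norm x = 1" for x
    using fib[of x "s *\<^sub>R x"] s that by auto
  have onX: "continuous_on ?S (\<lambda>x. f (q x))" "\<And>x. norm x = 1 \<Longrightarrow> norm (f (q x)) = 1"
    if "continuous_map X unit_sphere f" for f :: "'c \<Rightarrow> real^3"
    using continuous_map_compose[OF contq that]
    by (auto simp: top continuous_map_unit_sphere_iff)
  have prod: "prod_topology (top_of_set ?I) (unit_sphere :: 'a topology) = top_of_set (?I \<times> ?S)"
    by (simp add: top)
  obtain e :: 'a where e: "e \<in> Basis"
    using nonempty_Basis by blast
  have homotopicI: "homotopic_with (\<lambda>_. True) X S2 f g"
    if L: "continuous_on (?I \<times> ?S) L" "\<And>z. z \<in> ?I \<times> ?S \<Longrightarrow> norm (L z) = 1"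
      and Ls: "\<And>t x. t \<in> ?I \<Longrightarrow> norm x = 1 \<Longrightarrow> L (t, s *\<^sub>R x) = L (t, x)"
      and fg: "\<And>x. norm x = 1 \<Longrightarrow> L (0, x) = f (q x)" "\<And>x. norm x = 1 \<Longrightarrow> L (1, x) = g (q x)"
    for L :: "real \<times> 'a \<Rightarrow> real^3" and f g
    by (rule quotient_homotopy[OF q, of _ L])
       (use L Ls fg fib in \<open>auto simp: prod continuous_map_unit_sphere_iff\<close>)
  have homotopic_uminus: "homotopic_with (\<lambda>_. True) X S2 f (\<lambda>x. - f x)"
    if f: "continuous_map X S2 f" for f
  proof -
    have inv: "f (q (s *\<^sub>R x)) = f (q x)" if "norm x = 1" for x
      using qs[OF that] by simp
    obtain K :: "real \<times> 'a \<Rightarrow> real^3" where "continuous_on (?I \<times> ?S) K"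
      "\<And>t x. norm x = 1 \<Longrightarrow> norm (K (t, x)) = 1"
      "\<And>x. norm x = 1 \<Longrightarrow> K (0, x) = f (q x)" "\<And>x. norm x = 1 \<Longrightarrow> K (1, x) = - f (q x)"
      "\<And>t x. norm x = 1 \<Longrightarrow> K (t, s *\<^sub>R x) = K (t, x)"
      using homotopy_uminus[OF dim onX(1)[OF f] onX(2)[OF f] s inv] by blast
    then show ?thesis
      by (intro homotopicI[of K]) auto
  qed

  fix f g :: "'c \<Rightarrow> real^3"
  assume f: "continuous_map X S2 f" and g: "continuous_map X S2 g"
    and "homotopic_with (\<lambda>_. True) X RP2 (double_cover2 \<circ> f) (double_cover2 \<circ> g)"
  then obtain H where H: "continuous_map (prod_topology (top_of_set ?I) X) RP2 H"
      "\<And>x. H (0, x) = double_cover2 (f x)" "\<And>x. H (1, x) = double_cover2 (g x)"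
    by (auto simp: homotopic_with_def)
  define K where "K z = H (fst z, q (snd z))" for z
  have "continuous_map (prod_topology (top_of_set ?I) unit_sphere) (prod_topology (top_of_set ?I) X)
      (\<lambda>z. (fst z, q (snd z)))"
    by (auto simp: continuous_map_pairwise o_def intro!: continuous_map_fst
        continuous_map_compose[OF continuous_map_snd contq, unfolded o_def])
  then have K: "continuous_map (top_of_set (?I \<times> ?S)) RP2 K"
    using continuous_map_compose[OF _ H(1)] by (simp add: prod K_def[abs_def] o_def)
  obtain L where L: "continuous_on (?I \<times> ?S) L" "\<And>z. z \<in> ?I \<times> ?S \<Longrightarrow> norm (L z) = 1"
    "\<And>z. z \<in> ?I \<times> ?S \<Longrightarrow> antipodal_proj (L z) = K z" "\<And>x. x \<in> ?S \<Longrightarrow> L (0, x) = f (q x)"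
    by (rule homotopy_lift_real_projective_space[OF compact_sphere conn K onX(1)[OF f]])
       (use onX(2)[OF f] H(2) in \<open>auto simp: K_def\<close>)
  have L_nz: "L z \<noteq> 0" if "z \<in> ?I \<times> ?S" for z
    using L(2)[OF that] by auto
  have sS: "s *\<^sub>R x \<in> ?S" if "x \<in> ?S" for x
    using that s by auto
  \<comment> \<open>\<open>K\<close> is \<open>s\<close>-invariant, so its lift \<open>L\<close> is
    invariant up to one global sign; at time 0 it equals \<open>f \<circ> q\<close>, which forces
    the sign to be plus.\<close>
  have "(\<forall>z\<in>?I \<times> ?S. L (fst z, s *\<^sub>R snd z) = L z) \<or> (\<forall>z\<in>?I \<times> ?S. L (fst z, s *\<^sub>R snd z) = - L z)"
  proof (rule eq_or_eq_uminus_constant[OF _ L(1) _ L_nz])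
    show "connected (?I \<times> ?S)"
      using conn by (intro connected_Times) auto
    show "continuous_on (?I \<times> ?S) (\<lambda>z. L (fst z, s *\<^sub>R snd z))"
      by (rule continuous_on_compose2[OF L(1)]) (use sS in \<open>auto intro!: continuous_intros\<close>)
    fix z assume z: "z \<in> ?I \<times> ?S"
    then have "antipodal_proj (L (fst z, s *\<^sub>R snd z)) = antipodal_proj (L z)"
      using L(3)[of z] L(3)[of "(fst z, s *\<^sub>R snd z)"] sS qs[of "snd z"] by (auto simp: K_def)
    then show "L (fst z, s *\<^sub>R snd z) = L z \<or> L (fst z, s *\<^sub>R snd z) = - L z"
      by (simp add: antipodal_proj_eq_iff)
  qed
  moreover have "L (0, s *\<^sub>R e) \<noteq> - L (0, e)"
    using L(4)[of "s *\<^sub>R e"] L(4)[of e] qs[of e] sS[of e] L_nz[of "(0, e)"] e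
    by (simp add: eq_uminus_iff_eq_0)
  ultimately have Ls: "L (t, s *\<^sub>R x) = L (t, x)" if "t \<in> ?I" "norm x = 1" for t x
    using that e by (metis (no_types, lifting) SigmaI atLeastAtMost_iff fst_conv snd_conv mem_sphere_0
        norm_Basis order_refl zero_le_one)
  have "(\<forall>x\<in>?S. g (q x) = L (1, x)) \<or> (\<forall>x\<in>?S. g (q x) = - L (1, x))"
  proof (rule eq_or_eq_uminus_constant[OF conn _ onX(1)[OF g]])
    show "continuous_on ?S (\<lambda>x. L (1, x))"
      by (rule continuous_on_compose2[OF L(1)]) (auto intro!: continuous_intros)
    show "L (1, x) \<noteq> 0" "g (q x) = L (1, x) \<or> g (q x) = - L (1, x)" if "x \<in> ?S" for x
      using L_nz[of "(1, x)"] L(3)[of "(1, x)"] that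
      by (auto simp: K_def H(3) antipodal_proj_eq_iff)
  qed
  then show "homotopic_with (\<lambda>_. True) X S2 f g"
  proof
    assume "\<forall>x\<in>?S. g (q x) = L (1, x)"
    then show ?thesis
      using L Ls by (intro homotopicI[of L]) auto
  next
    assume "\<forall>x\<in>?S. g (q x) = - L (1, x)"
    then have "L (1, x) = - g (q x)" if "x \<in> ?S" for x
      using that by simp
    \<comment> \<open>Here \<open>L\<close> joins \<open>f\<close> to \<open>- g\<close>, and
      \<open>homotopic_uminus\<close> joins \<open>g\<close> to \<open>- g\<close>.\<close>
    then have "homotopic_with (\<lambda>_. True) X S2 f (\<lambda>x. - g x)"
      using L Ls by (intro homotopicI[of L]) auto
    then show ?thesis
      using homotopic_uminus[OF g] homotopic_with_trans homotopic_with_symD by metis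
  qed
next
  let ?S = "sphere (0::'a) 1"
  fix f :: "'c \<Rightarrow> (real^3) set"
  assume "continuous_map X RP2 f"
  then have "continuous_map unit_sphere RP2 (f \<circ> q)"
    using q by (meson continuous_map_compose quotient_imp_continuous_map)
  then obtain F where F: "continuous_on ?S F"
      "\<And>x. norm x = 1 \<Longrightarrow> norm (F x) = 1 \<and> antipodal_proj (F x) = f (q x)"
    using sphere_lift_real_projective_space[OF dim] by (metis o_apply)
  have sS: "norm (s *\<^sub>R x) = 1" if "norm x = 1" for x :: 'a
    using that s by auto
  have qs: "q (s *\<^sub>R x) = q x" if "norm x = 1" for x
    using fib[of x "s *\<^sub>R x"] s that by auto
  \<comment> \<open>The lift descends to \<open>X\<close> when it is \<open>s\<close>-invariant. The
    other sign is impossible: for \<open>s = 1\<close> it would make \<open>F\<close> vanish, for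
    \<open>s = -1\<close> it would make \<open>F\<close> an odd map to the 2-sphere.\<close>
  have "(\<forall>x\<in>?S. F (s *\<^sub>R x) = F x) \<or> (\<forall>x\<in>?S. F (s *\<^sub>R x) = - F x)"
  proof (rule eq_or_eq_uminus_constant[OF _ F(1)])
    show "connected ?S"
      by (rule connected_sphere) (use dim in auto)
    show "continuous_on ?S (\<lambda>x. F (s *\<^sub>R x))"
      by (rule continuous_on_compose2[OF F(1)]) (use sS in \<open>auto intro!: continuous_intros\<close>)
    show "F x \<noteq> 0" "F (s *\<^sub>R x) = F x \<or> F (s *\<^sub>R x) = - F x" if "x \<in> ?S" for x
      using F(2)[of x] F(2)[of "s *\<^sub>R x"] sS[of x] qs[of x] that
      by (auto simp: antipodal_proj_eq_iff[symmetric])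
  qed
  moreover have False if odd: "\<forall>x\<in>?S. F (s *\<^sub>R x) = - F x"
  proof (cases "s = 1")
    case True
    obtain e :: 'a where e: "e \<in> Basis"
      using nonempty_Basis by blast
    then have "F e = - F e"
      using odd True by force
    then show False
      using F(2)[of e] e by (auto simp: eq_uminus_iff_eq_0)
  next
    case False
    then have "s = -1"
      using s by simp
    then show False
      using no_odd_map_sphere_to_S2[OF dim F(1)] F(2) odd by simp
  qed
  ultimately have Fs: "\<And>x. norm x = 1 \<Longrightarrow> F (s *\<^sub>R x) = F x"
    by auto
  have "continuous_map unit_sphere S2 F"
    using F by (simp add: unit_sphere_def[where 'a='a] continuous_map_unit_sphere_iff)
  then obtain g where g: "continuous_map X S2 g" "\<And>x. x \<in> topspace unit_sphere \<Longrightarrow> g (q x) = F x"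
    by (rule quotient_map_lift_exists[OF q]) (use fib Fs in auto)
  have "double_cover2 (g y) = f y" if "y \<in> topspace X" for y
    using g(2) F(2) that quotient_imp_surjective_map[OF q] by force
  then show "\<exists>g. continuous_map X S2 g \<and> (\<forall>x\<in>topspace X. double_cover2 (g x) = f x)"
    using g(1) by blast
qed


theorem lemma5p1:
  shows "bij_betw (postcomp_class S3 RP2 double_cover2)
           (homotopy_classes S3 S2) (homotopy_classes S3 RP2) \<and>
         bij_betw (postcomp_class RP3 RP2 double_cover2)
           (homotopy_classes RP3 S2) (homotopy_classes RP3 RP2)"
proof
  show "bij_betw (postcomp_class S3 RP2 double_cover2)
           (homotopy_classes S3 S2) (homotopy_classes S3 RP2)"
  proof (rule bij_betw_postcomp_double_cover[where q = id and s = 1])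
    show "quotient_map S3 S3 id"
      using homeomorphic_map_id unfolding homeomorphic_map_def by blast
  qed auto
  show "bij_betw (postcomp_class RP3 RP2 double_cover2)
           (homotopy_classes RP3 S2) (homotopy_classes RP3 RP2)"
  proof (rule bij_betw_postcomp_double_cover[where q = antipodal_proj and s = "-1"])
    show "quotient_map S3 RP3 antipodal_proj"
      unfolding real_projective_space_def by (rule quotient_map_quotient_topology)
    show "antipodal_proj x = antipodal_proj y \<longleftrightarrow> y = x \<or> y = (- 1) *\<^sub>R x" for x y :: "real^4"
      unfolding antipodal_proj_eq_iff scaleR_minus1_left by (metis minus_minus)
  qed auto
qed

end
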